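(* Let $n\geq 1$, let $(G,\mathscr L)$ be a linear space with a parallelism $\varpi$ having exactly $n$ blocks, let $\beta$ be a bijection from the blocks of $\varpi$ onto $C=\{c_1,\dots,c_n\}$, and let $\lambda(p,q)=\beta(\text{block of }\overline{pq})$ for distinct $p,q\in G$. Then: (i) for every $c\in C$ there exist three distinct points $p,q,r\in G$ with $\lambda(p,q)=\lambda(q,r)=\lambda(p,r)=c$ if and only if (LS4) each block of $\varpi$ contains a line with at least $3$ points; (ii) for every three pairwise distinct $a,b,c\in C$ there exist points $p,q,r\in G$ with $\lambda(p,q)=a$, $\lambda(q,r)=b$, $\lambda(r,p)=c$ if and only if (LS5) for all pairwise distinct blocks $d_1,d_2,d_3$ of $\varpi$ there are three non-collinear points $p_1,p_2,p_3\in G$ with $\overline{p_1p_2}\in d_1$, $\overline{p_2p_3}\in d_2$, $\overline{p_3p_1}\in d_3$. Consequently, the map $X\mapsto\bigcup_{a\in X}\lambda^{-1}(a)$ realises all monochromatic triangles of $\mathfrak{E}^{\{1,3\}}_{n+1}$ exactly when (LS4) holds and all trichromatic triangles exactly when (LS5) holds.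
   Context: A linear space is a pair $(G,\mathscr L)$ with $G$ a set of points and $\mathscr L$ a family of subsets of $G$ (lines) such that every pair of distinct points is contained in a line, any two distinct lines meet in at most one point, and every line has at least two points; $\overline{pq}$ denotes the unique line through distinct points $p,q$; points are collinear if they lie on a common line. A parallelism of $(G,\mathscr L)$ is an equivalence relation $\varpi$ on $\mathscr L$ such that distinct lines in the same block are disjoint. $\mathfrak{E}^{\{1,3\}}_{n+1}$ is the algebra on atoms $\{1'\}\cup C$ in which a triple of proper colours is consistent iff it is monochromatic or trichromatic; "realising" a consistent triple $(a,b,c)$ of proper colours means there are points $p,q,r$ with $\lambda(p,q)=a,\lambda(q,r)=b,\lambda(p,r)=c$. *)

theory Defs
  imports Main
begin

section \<open>Linear spaces and parallelisms\<close>

text \<open>Stated through a subset, so that infinite sets also count (\<open>card\<close> is \<open>0\<close> on them).\<close>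

definition at_least :: "nat \<Rightarrow> 'p set \<Rightarrow> bool" where
  "at_least k A \<longleftrightarrow> (\<exists>S\<subseteq>A. finite S \<and> card S = k)"

locale linear_space =
  fixes G :: "'p set" and L :: "'p set set"
  assumes lines_subset: "\<And>l. l \<in> L \<Longrightarrow> l \<subseteq> G"
    and line_exists: "\<And>p q. p \<in> G \<Longrightarrow> q \<in> G \<Longrightarrow> p \<noteq> q \<Longrightarrow> \<exists>l\<in>L. p \<in> l \<and> q \<in> l"
    and lines_meet: "\<And>l m p q. l \<in> L \<Longrightarrow> m \<in> L \<Longrightarrow> l \<noteq> m \<Longrightarrow>
                       p \<in> l \<inter> m \<Longrightarrow> q \<in> l \<inter> m \<Longrightarrow> p = q"
    and two_points: "\<And>l. l \<in> L \<Longrightarrow> at_least 2 l"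

definition line_through :: "'p set set \<Rightarrow> 'p \<Rightarrow> 'p \<Rightarrow> 'p set" where
  "line_through L p q = (THE l. l \<in> L \<and> p \<in> l \<and> q \<in> l)"

definition collinear_in :: "'p set set \<Rightarrow> 'p set \<Rightarrow> bool" where
  "collinear_in L S \<longleftrightarrow> (\<exists>l\<in>L. S \<subseteq> l)"

definition parallelism :: "'p set set \<Rightarrow> ('p set \<times> 'p set) set \<Rightarrow> bool" where
  "parallelism L par \<longleftrightarrow> equiv L par \<and>
     (\<forall>l\<in>L. \<forall>m\<in>L. (l, m) \<in> par \<longrightarrow> l \<noteq> m \<longrightarrow> l \<inter> m = {})"

text \<open>The blocks of \<open>par\<close> are the members of \<open>L // par\<close>; the block of \<open>l\<close> is \<open>par `` {l}\<close>.\<close>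

definition LS4 :: "'p set set \<Rightarrow> ('p set \<times> 'p set) set \<Rightarrow> bool" where
  "LS4 L par \<longleftrightarrow> (\<forall>d\<in>L // par. \<exists>l\<in>d. at_least 3 l)"

definition LS5 :: "'p set \<Rightarrow> 'p set set \<Rightarrow> ('p set \<times> 'p set) set \<Rightarrow> bool" where
  "LS5 G L par \<longleftrightarrow>
     (\<forall>d1\<in>L // par. \<forall>d2\<in>L // par. \<forall>d3\<in>L // par.
        d1 \<noteq> d2 \<and> d2 \<noteq> d3 \<and> d1 \<noteq> d3 \<longrightarrow>
        (\<exists>p1\<in>G. \<exists>p2\<in>G. \<exists>p3\<in>G. p1 \<noteq> p2 \<and> p2 \<noteq> p3 \<and> p1 \<noteq> p3 \<and>
           \<not> collinear_in L {p1, p2, p3} \<and>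
           line_through L p1 p2 \<in> d1 \<and> line_through L p2 p3 \<in> d2 \<and>
           line_through L p3 p1 \<in> d3))"

section \<open>The algebra on the atoms \<open>{1'} \<union> C\<close>\<close>

text \<open>\<open>Ident\<close> is the identity atom \<open>1'\<close>; the proper colours are the atoms in \<open>Colour ` C\<close>.\<close>

datatype 'c atom = Ident | Colour 'c

definition atoms :: "'c set \<Rightarrow> 'c atom set" where
  "atoms C = insert Ident (Colour ` C)"

definition monochromatic :: "'a \<Rightarrow> 'a \<Rightarrow> 'a \<Rightarrow> bool" where
  "monochromatic a b c \<longleftrightarrow> a = b \<and> b = c"

definition trichromatic :: "'a \<Rightarrow> 'a \<Rightarrow> 'a \<Rightarrow> bool" where
  "trichromatic a b c \<longleftrightarrow> a \<noteq> b \<and> b \<noteq> c \<and> a \<noteq> c"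

text \<open>Triples involving \<open>1'\<close> are governed by the identity law, as all atoms are self-converse.\<close>

fun consistent :: "'c atom \<Rightarrow> 'c atom \<Rightarrow> 'c atom \<Rightarrow> bool" where
  "consistent Ident y z \<longleftrightarrow> y = z"
| "consistent (Colour a) Ident z \<longleftrightarrow> z = Colour a"
| "consistent (Colour a) (Colour b) Ident \<longleftrightarrow> a = b"
| "consistent (Colour a) (Colour b) (Colour c) \<longleftrightarrow> monochromatic a b c \<or> trichromatic a b c"

record 'e relation_type_algebra =
  elements :: "'e set"
  join :: "'e \<Rightarrow> 'e \<Rightarrow> 'e"
  complement :: "'e \<Rightarrow> 'e"
  identity :: "'e"
  conv :: "'e \<Rightarrow> 'e"
  comp :: "'e \<Rightarrow> 'e \<Rightarrow> 'e"

definition E13 :: "'c set \<Rightarrow> 'c atom set relation_type_algebra" where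
  "E13 C = \<lparr>
     elements = Pow (atoms C),
     join = (\<union>),
     complement = (\<lambda>X. atoms C - X),
     identity = {Ident},
     conv = (\<lambda>X. X),
     comp = (\<lambda>X Y. {z \<in> atoms C. \<exists>x\<in>X. \<exists>y\<in>Y. consistent x y z}) \<rparr>"

definition triangles :: "'c set \<Rightarrow> ('c atom \<times> 'c atom \<times> 'c atom) set" where
  "triangles C = {(a, b, c). a \<in> Colour ` C \<and> b \<in> Colour ` C \<and> c \<in> Colour ` C \<and>
                             {c} \<subseteq> comp (E13 C) {a} {b}}"

definition mono_triangles :: "'c set \<Rightarrow> ('c atom \<times> 'c atom \<times> 'c atom) set" where
  "mono_triangles C = {(a, b, c) \<in> triangles C. monochromatic a b c}"

definition tri_triangles :: "'c set \<Rightarrow> ('c atom \<times> 'c atom \<times> 'c atom) set" where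
  "tri_triangles C = {(a, b, c) \<in> triangles C. trichromatic a b c}"

section \<open>Colouring pairs of points\<close>

text \<open>On the diagonal the colouring takes the value \<open>1'\<close>, so the preimage of \<open>1'\<close> is the identity
  on the points, and \<open>colouring L par \<beta> p q = Colour c\<close> entails \<open>p \<noteq> q\<close>.\<close>

definition colouring ::
    "'p set set \<Rightarrow> ('p set \<times> 'p set) set \<Rightarrow> ('p set set \<Rightarrow> 'c) \<Rightarrow> 'p \<Rightarrow> 'p \<Rightarrow> 'c atom" where
  "colouring L par \<beta> p q =
     (if p = q then Ident else Colour (\<beta> (par `` {line_through L p q})))"

definition preimage_map :: "'p set \<Rightarrow> ('p \<Rightarrow> 'p \<Rightarrow> 'a) \<Rightarrow> 'a set \<Rightarrow> ('p \<times> 'p) set" where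
  "preimage_map G lam X = (\<Union>a\<in>X. {(p, q) \<in> G \<times> G. lam p q = a})"

definition realises ::
    "'p set \<Rightarrow> ('a set \<Rightarrow> ('p \<times> 'p) set) \<Rightarrow> 'a \<times> 'a \<times> 'a \<Rightarrow> bool" where
  "realises G \<phi> = (\<lambda>(a, b, c). \<exists>p\<in>G. \<exists>q\<in>G. \<exists>r\<in>G.
     (p, q) \<in> \<phi> {a} \<and> (q, r) \<in> \<phi> {b} \<and> (p, r) \<in> \<phi> {c})"

lemma realises_preimage_map_iff:
  "realises G (preimage_map G lam) (a, b, c) \<longleftrightarrow>
     (\<exists>p\<in>G. \<exists>q\<in>G. \<exists>r\<in>G. lam p q = a \<and> lam q r = b \<and> lam p r = c)"
  by (auto simp: realises_def preimage_map_def)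

end

theory Submission
  imports Defs
begin

text \<open>Lines of one block are disjoint or equal, so two lines \<open>pq\<close> and \<open>qr\<close> of the same colour
  coincide: a monochromatic triangle is a line with three points. Lines of different colours are
  different, so a trichromatic triangle is never collinear.\<close>

text \<open>Trades the cardinality of a subset for three named points, the shape in which triangles
  arise.\<close>

lemma at_least_3_iff:
  "at_least 3 A \<longleftrightarrow> (\<exists>p\<in>A. \<exists>q\<in>A. \<exists>r\<in>A. p \<noteq> q \<and> q \<noteq> r \<and> p \<noteq> r)"
proof
  assume "at_least 3 A"
  then obtain S where "S \<subseteq> A" "card S = 3" by (auto simp: at_least_def)
  then show "\<exists>p\<in>A. \<exists>q\<in>A. \<exists>r\<in>A. p \<noteq> q \<and> q \<noteq> r \<and> p \<noteq> r"
    unfolding card_3_iff by blast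
next
  assume "\<exists>p\<in>A. \<exists>q\<in>A. \<exists>r\<in>A. p \<noteq> q \<and> q \<noteq> r \<and> p \<noteq> r"
  then obtain p q r where "{p, q, r} \<subseteq> A" "p \<noteq> q" "q \<noteq> r" "p \<noteq> r" by auto
  moreover from this have "card {p, q, r} = 3" by simp
  ultimately show "at_least 3 A" unfolding at_least_def by blast
qed

lemma line_through_commute: "line_through L p q = line_through L q p"
  unfolding line_through_def by (simp add: conj_commute)

lemma colouring_commute: "colouring L par \<beta> p q = colouring L par \<beta> q p"
  by (simp add: colouring_def line_through_commute[of L p q])

context linear_space
begin

text \<open>Any competitor \<open>m\<close> for the description shares both \<open>p\<close> and
  \<open>q\<close> with \<open>l\<close>, and different lines share at most one point.\<close>

lemma line_through_eq:
  assumes "l \<in> L" "p \<in> l" "q \<in> l" "p \<noteq> q"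
  shows "line_through L p q = l"
  unfolding line_through_def
proof (rule the_equality)
  show "m = l" if "m \<in> L \<and> p \<in> m \<and> q \<in> m" for m
    using lines_meet[of m l p q] that assms by blast
qed (use assms in blast)

lemma
  assumes "p \<in> G" "q \<in> G" "p \<noteq> q"
  shows line_through_in: "line_through L p q \<in> L"
    and line_through_left: "p \<in> line_through L p q"
    and line_through_right: "q \<in> line_through L p q"
proof -
  obtain l where "l \<in> L" "p \<in> l" "q \<in> l"
    using line_exists assms by blast
  then show "line_through L p q \<in> L" "p \<in> line_through L p q" "q \<in> line_through L p q"
    using line_through_eq assms(3) by auto
qed

end

locale parallel_space = linear_space G L
  for G :: "'p set" and L :: "'p set set" +
  fixes par :: "('p set \<times> 'p set) set"
    and C :: "'c set" and \<beta> :: "'p set set \<Rightarrow> 'c"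
  assumes parallelism: "parallelism L par"
    and bij: "bij_betw \<beta> (L // par) C"
begin

abbreviation "lam \<equiv> colouring L par \<beta>"

lemma equiv: "equiv L par"
  using parallelism by (simp add: parallelism_def)

lemma colours_eq: "C = \<beta> ` (L // par)"
  using bij by (simp add: bij_betw_def)

lemma beta_eq_iff: "d \<in> L // par \<Longrightarrow> e \<in> L // par \<Longrightarrow> \<beta> d = \<beta> e \<longleftrightarrow> d = e"
  using bij by (auto simp: bij_betw_def inj_on_eq_iff)

lemma block_subset: "d \<in> L // par \<Longrightarrow> l \<in> d \<Longrightarrow> l \<in> L"
  using equiv in_quotient_imp_subset by blast

text \<open>Blocks are equivalence classes, so one that meets the class of \<open>l\<close> in
  \<open>l\<close> is that class. This turns equations between blocks, as in
  \<open>colouring\<close>, into the memberships used by \<open>LS4\<close> and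
  \<open>LS5\<close>.\<close>

lemma block_eq_iff:
  assumes "d \<in> L // par" "l \<in> L"
  shows "par `` {l} = d \<longleftrightarrow> l \<in> d"
proof
  show "l \<in> d" if "par `` {l} = d"
    using that equiv_class_self[OF equiv assms(2)] by simp
  show "par `` {l} = d" if "l \<in> d"
    using quotient_disj[OF equiv quotientI[OF assms(2)] assms(1)]
      equiv_class_self[OF equiv assms(2)] that by blast
qed

lemma blocks_disjoint: "d \<in> L // par \<Longrightarrow> e \<in> L // par \<Longrightarrow> l \<in> d \<Longrightarrow> l \<in> e \<Longrightarrow> d = e"
  using quotient_disj[OF equiv] by blast

lemma block_lines_meet_eq:
  assumes "d \<in> L // par" "l \<in> d" "m \<in> d" "p \<in> l" "p \<in> m"
  shows "l = m"
proof -
  \<comment> \<open>\<open>quotient_eq_iff\<close> compares two classes; \<open>d\<close> is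
    supplied for both, so their equality yields the relation between \<open>l\<close> and
    \<open>m\<close>.\<close>
  have "(l, m) \<in> par" using quotient_eq_iff[OF equiv assms(1,1-3)] by simp
  then show ?thesis
    using parallelism assms block_subset unfolding parallelism_def by blast
qed

text \<open>Injectivity of \<open>\<beta>\<close> on blocks lets a colour determine its block, and
  the value \<open>Ident\<close> on the diagonal accounts for \<open>p \<noteq> q\<close>. Both
  triangle lemmas below translate colours into lines through this equivalence.\<close>

lemma colouring_eq_iff:
  assumes "p \<in> G" "q \<in> G" "d \<in> L // par"
  shows "lam p q = Colour (\<beta> d) \<longleftrightarrow> p \<noteq> q \<and> line_through L p q \<in> d"
proof (cases "p = q")
  case False
  note l = line_through_in[OF assms(1,2) False]
  show ?thesis
    using False beta_eq_iff[OF quotientI[OF l] assms(3)] block_eq_iff[OF assms(3) l]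
    by (simp add: colouring_def)
qed (simp add: colouring_def)

text \<open>For the converse direction, any two of three points on a line span that same line, so
  all three pairs receive the colour of its block.\<close>

lemma mono_triangle_iff:
  assumes d: "d \<in> L // par"
  shows "(\<exists>p\<in>G. \<exists>q\<in>G. \<exists>r\<in>G. lam p q = Colour (\<beta> d) \<and> lam q r = Colour (\<beta> d) \<and>
            lam p r = Colour (\<beta> d))
         \<longleftrightarrow> (\<exists>l\<in>d. at_least 3 l)"
proof
  assume "\<exists>p\<in>G. \<exists>q\<in>G. \<exists>r\<in>G. lam p q = Colour (\<beta> d) \<and> lam q r = Colour (\<beta> d) \<and>
            lam p r = Colour (\<beta> d)"
  \<comment> \<open>The third colour gives \<open>p \<noteq> r\<close>, which excludes the
    degenerate triangle that returns from \<open>q\<close> to \<open>p\<close>.\<close>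
  then obtain p q r where G: "p \<in> G" "q \<in> G" "r \<in> G"
    and neq: "p \<noteq> q" "q \<noteq> r" "p \<noteq> r"
    and lines: "line_through L p q \<in> d" "line_through L q r \<in> d"
    using colouring_eq_iff d by blast
  have "line_through L p q = line_through L q r"
    by (rule block_lines_meet_eq[OF d lines, of q])
      (simp_all add: G neq line_through_right line_through_left)
  then have "at_least 3 (line_through L p q)"
    using line_through_left line_through_right G neq unfolding at_least_3_iff by metis
  with lines(1) show "\<exists>l\<in>d. at_least 3 l" ..
next
  assume "\<exists>l\<in>d. at_least 3 l"
  then obtain l p q r where l: "l \<in> d" "p \<in> l" "q \<in> l" "r \<in> l"
    and neq: "p \<noteq> q" "q \<noteq> r" "p \<noteq> r"
    unfolding at_least_3_iff by blast
  note L = block_subset[OF d l(1)]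
  have G: "p \<in> G" "q \<in> G" "r \<in> G" using lines_subset[OF L] l by auto
  have "lam p q = Colour (\<beta> d)" "lam q r = Colour (\<beta> d)" "lam p r = Colour (\<beta> d)"
    using l neq G d by (simp_all add: colouring_eq_iff line_through_eq[OF L])
  with G show "\<exists>p\<in>G. \<exists>q\<in>G. \<exists>r\<in>G. lam p q = Colour (\<beta> d) \<and> lam q r = Colour (\<beta> d) \<and>
            lam p r = Colour (\<beta> d)" by blast
qed

text \<open>Supplies the clause of \<open>LS5\<close> that the colours do not mention: a common line
  would equal both spanned lines and so lie in two disjoint blocks.\<close>

lemma not_collinear:
  assumes "d1 \<in> L // par" "d2 \<in> L // par" "d1 \<noteq> d2" "p \<noteq> q" "q \<noteq> r"
    and "line_through L p q \<in> d1" "line_through L q r \<in> d2"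
  shows "\<not> collinear_in L {p, q, r}"
proof
  assume "collinear_in L {p, q, r}"
  then obtain l where l: "l \<in> L" "p \<in> l" "q \<in> l" "r \<in> l" by (auto simp: collinear_in_def)
  then have "line_through L p q = l" "line_through L q r = l"
    using assms line_through_eq by auto
  with assms blocks_disjoint show False by metis
qed

lemma tri_triangle_iff:
  assumes d: "d1 \<in> L // par" "d2 \<in> L // par" "d3 \<in> L // par" and "d1 \<noteq> d2"
  shows "(\<exists>p\<in>G. \<exists>q\<in>G. \<exists>r\<in>G. lam p q = Colour (\<beta> d1) \<and> lam q r = Colour (\<beta> d2) \<and>
            lam r p = Colour (\<beta> d3))
         \<longleftrightarrow> (\<exists>p\<in>G. \<exists>q\<in>G. \<exists>r\<in>G. p \<noteq> q \<and> q \<noteq> r \<and> p \<noteq> r \<and> \<not> collinear_in L {p, q, r} \<and>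
            line_through L p q \<in> d1 \<and> line_through L q r \<in> d2 \<and> line_through L r p \<in> d3)"
  using not_collinear[OF d(1,2) assms(4)] d
  \<comment> \<open>The same three points serve on both sides, so the equivalence is checked under
    the quantifiers.\<close>
  by (intro bex_cong refl) (auto simp: colouring_eq_iff)

text \<open>As \<open>\<beta>\<close> maps the blocks onto \<open>C\<close>, quantifying over
  colours amounts to quantifying over blocks.\<close>

lemma LS4_iff:
  "LS4 L par \<longleftrightarrow> (\<forall>c\<in>C. \<exists>p\<in>G. \<exists>q\<in>G. \<exists>r\<in>G.
     lam p q = Colour c \<and> lam q r = Colour c \<and> lam p r = Colour c)"
  by (simp only: LS4_def colours_eq ball_simps mono_triangle_iff cong: ball_cong)

lemma LS5_iff:
  "LS5 G L par \<longleftrightarrow> (\<forall>a\<in>C. \<forall>b\<in>C. \<forall>c\<in>C. a \<noteq> b \<and> b \<noteq> c \<and> a \<noteq> c \<longrightarrow>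
     (\<exists>p\<in>G. \<exists>q\<in>G. \<exists>r\<in>G. lam p q = Colour a \<and> lam q r = Colour b \<and> lam r p = Colour c))"
  unfolding LS5_def colours_eq ball_simps
  \<comment> \<open>\<open>imp_cong\<close> makes the inequality of the colours available where
    \<open>tri_triangle_iff\<close> asks for different blocks; \<open>beta_eq_iff\<close> converts
    between the two.\<close>
  by (intro ball_cong refl imp_cong tri_triangle_iff[symmetric]) (auto simp: beta_eq_iff)

end

text \<open>Three equal colours satisfy the monochromatic clause of \<open>consistent\<close>, so
  these triangles are parametrised by \<open>C\<close>. The next lemma does the same with the
  trichromatic clause.\<close>

lemma mono_triangles_eq: "mono_triangles C = (\<lambda>c. (Colour c, Colour c, Colour c)) ` C"
  by (auto simp: mono_triangles_def triangles_def E13_def atoms_def monochromatic_def)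

lemma tri_triangles_eq:
  "tri_triangles C = {(Colour a, Colour b, Colour c) | a b c.
     a \<in> C \<and> b \<in> C \<and> c \<in> C \<and> a \<noteq> b \<and> b \<noteq> c \<and> a \<noteq> c}"
  by (auto simp: tri_triangles_def triangles_def E13_def atoms_def trichromatic_def)

theorem theorem30:
  fixes n :: nat
    and G :: "'p set" and L :: "'p set set"
    and par :: "('p set \<times> 'p set) set"
    and C :: "'c set" and \<beta> :: "'p set set \<Rightarrow> 'c"
  assumes "n \<ge> 1"
    and "linear_space G L"
    and "parallelism L par"
    and "card (L // par) = n"
    and "card C = n"
    and "bij_betw \<beta> (L // par) C"
  shows
    "((\<forall>c\<in>C. \<exists>p\<in>G. \<exists>q\<in>G. \<exists>r\<in>G. p \<noteq> q \<and> q \<noteq> r \<and> p \<noteq> r \<and>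
         colouring L par \<beta> p q = Colour c \<and> colouring L par \<beta> q r = Colour c \<and>
         colouring L par \<beta> p r = Colour c)
       \<longleftrightarrow> LS4 L par)
     \<and> ((\<forall>a\<in>C. \<forall>b\<in>C. \<forall>c\<in>C. a \<noteq> b \<and> b \<noteq> c \<and> a \<noteq> c \<longrightarrow>
         (\<exists>p\<in>G. \<exists>q\<in>G. \<exists>r\<in>G.
            colouring L par \<beta> p q = Colour a \<and> colouring L par \<beta> q r = Colour b \<and>
            colouring L par \<beta> r p = Colour c))
       \<longleftrightarrow> LS5 G L par)
     \<and> ((\<forall>t\<in>mono_triangles C. realises G (preimage_map G (colouring L par \<beta>)) t)
       \<longleftrightarrow> LS4 L par)
     \<and> ((\<forall>t\<in>tri_triangles C. realises G (preimage_map G (colouring L par \<beta>)) t)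
       \<longleftrightarrow> LS5 G L par)"
proof -
  interpret parallel_space G L par C \<beta>
    using assms by (simp add: parallel_space_def parallel_space_axioms_def)
  \<comment> \<open>Bridges (i), which lists the inequalities, and \<open>LS4_iff\<close>, which
    leaves them to the value \<open>Ident\<close> on the diagonal.\<close>
  have distinct: "p \<noteq> q \<and> q \<noteq> r \<and> p \<noteq> r \<and>
      lam p q = Colour c \<and> lam q r = Colour c \<and> lam p r = Colour c \<longleftrightarrow>
      lam p q = Colour c \<and> lam q r = Colour c \<and> lam p r = Colour c" for p q r c
    by (auto simp: colouring_def)
  have mono: "(\<forall>t\<in>mono_triangles C. realises G (preimage_map G lam) t) \<longleftrightarrow> LS4 L par"
    by (simp add: mono_triangles_eq realises_preimage_map_iff LS4_iff)
  have "(\<forall>t\<in>tri_triangles C. realises G (preimage_map G lam) t) \<longleftrightarrow>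
    (\<forall>a\<in>C. \<forall>b\<in>C. \<forall>c\<in>C. a \<noteq> b \<and> b \<noteq> c \<and> a \<noteq> c \<longrightarrow>
      realises G (preimage_map G lam) (Colour a, Colour b, Colour c))"
    unfolding tri_triangles_eq by blast
  \<comment> \<open>The sides differ in the orientation of the third pair: \<open>realises\<close>
    follows the composition from \<open>p\<close> to \<open>r\<close>, while \<open>LS5\<close> goes
    round the triangle from \<open>r\<close> back to \<open>p\<close>. Symmetry of the colouring
    reconciles them.\<close>
  also have "\<dots> \<longleftrightarrow> LS5 G L par"
    unfolding realises_preimage_map_iff LS5_iff
    by (subst (2) colouring_commute) (rule refl)
  finally have tri: "(\<forall>t\<in>tri_triangles C. realises G (preimage_map G lam) t) \<longleftrightarrow> LS5 G L par" .
  show ?thesis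
    unfolding distinct using mono tri LS4_iff LS5_iff by simp
qed

end
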